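(* Let $T$ be an infinite, locally finite tree and let $k$ be a positive integer. Then every vertex $x$ of $T$ is contained in a $k$-fort $F$ of $T$ with $\mathrm{br}(F)\le\max\{\mathrm{br}(T)-k,\,0\}$.
   Context: A $k$-fort in a graph with vertex set $V$ and edge set $E$ is a (nonempty) finite or infinite connected subset $F\subseteq V$ such that every $v\in F$ has at most $k$ neighbors outside $F$, i.e. $|\{w\in V\setminus F:(v,w)\in E\}|\le k$. A $k$-fort in a tree is viewed as a tree itself (the induced subtree). Branching number: for an infinite locally finite tree $T$ with a chosen root, $\mathrm{br}(T)$ is the supremum of the real numbers $\lambda\ge 1$ such that $T$ admits a flow of positive strength from the root to infinity in which the flow through each edge $e$ is at most $\lambda^{-|e|}$, where $|e|$ is the number of edges (including $e$) on the path from $e$ to the root. This does not depend on the choice of the root. For a finite tree the branching number is defined to be $0$. *)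

theory Defs
  imports Complex_Main "HOL-Library.Extended_Real"
begin

text \<open>
  A simple undirected graph is given by its vertex set \<open>V\<close> and its symmetric, irreflexive
  adjacency relation \<open>E\<close>. Both may be infinite.
\<close>

definition simple_graph :: "'a set \<Rightarrow> ('a \<times> 'a) set \<Rightarrow> bool" where
  "simple_graph V E \<longleftrightarrow> E \<subseteq> V \<times> V \<and> sym E \<and> irrefl E"

definition induced_edges :: "('a \<times> 'a) set \<Rightarrow> 'a set \<Rightarrow> ('a \<times> 'a) set" where
  "induced_edges E F = E \<inter> F \<times> F"

definition graph_connected :: "'a set \<Rightarrow> ('a \<times> 'a) set \<Rightarrow> bool" where
  "graph_connected V E \<longleftrightarrow> (\<forall>u\<in>V. \<forall>v\<in>V. (u, v) \<in> E\<^sup>*)"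

text \<open>
  The length condition excludes the closed walk \<open>u, v, u\<close> along a single undirected edge.
\<close>

definition graph_cycle :: "('a \<times> 'a) set \<Rightarrow> 'a list \<Rightarrow> bool" where
  "graph_cycle E c \<longleftrightarrow> length c \<ge> 3 \<and> distinct c \<and>
     successively (\<lambda>u v. (u, v) \<in> E) c \<and> (last c, hd c) \<in> E"

definition graph_tree :: "'a set \<Rightarrow> ('a \<times> 'a) set \<Rightarrow> bool" where
  "graph_tree V E \<longleftrightarrow> simple_graph V E \<and> V \<noteq> {} \<and> graph_connected V E \<and> (\<nexists>c. graph_cycle E c)"

definition locally_finite_graph :: "'a set \<Rightarrow> ('a \<times> 'a) set \<Rightarrow> bool" where
  "locally_finite_graph V E \<longleftrightarrow> (\<forall>v\<in>V. finite {w. (v, w) \<in> E})"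

definition k_fort :: "nat \<Rightarrow> 'a set \<Rightarrow> ('a \<times> 'a) set \<Rightarrow> 'a set \<Rightarrow> bool" where
  "k_fort k V E F \<longleftrightarrow> F \<subseteq> V \<and> F \<noteq> {} \<and> graph_connected F (induced_edges E F) \<and>
     (\<forall>v\<in>F. finite {w \<in> V - F. (v, w) \<in> E} \<and> card {w \<in> V - F. (v, w) \<in> E} \<le> k)"

definition graph_dist :: "('a \<times> 'a) set \<Rightarrow> 'a \<Rightarrow> 'a \<Rightarrow> nat" where
  "graph_dist E u v = (LEAST n. (u, v) \<in> E ^^ n)"

definition tree_children :: "('a \<times> 'a) set \<Rightarrow> 'a \<Rightarrow> 'a \<Rightarrow> 'a set" where
  "tree_children E r v = {w. (v, w) \<in> E \<and> graph_dist E r w = Suc (graph_dist E r v)}"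

text \<open>
  Flows from the root \<open>r\<close> to infinity: every edge is oriented away from \<open>r\<close>, and \<open>\<theta> v w \<ge> 0\<close> is
  the amount flowing from \<open>v\<close> to its child \<open>w\<close>. Values of \<open>\<theta>\<close> on other pairs are irrelevant. At
  every vertex other than \<open>r\<close> the inflow equals the outflow, so nothing is lost at leaves.
\<close>

definition root_flow :: "('a \<times> 'a) set \<Rightarrow> 'a \<Rightarrow> ('a \<Rightarrow> 'a \<Rightarrow> real) \<Rightarrow> bool" where
  "root_flow E r \<theta> \<longleftrightarrow>
     (\<forall>v. \<forall>w \<in> tree_children E r v. 0 \<le> \<theta> v w \<and> \<theta> v w = (\<Sum>u \<in> tree_children E r w. \<theta> w u))"

definition flow_strength :: "('a \<times> 'a) set \<Rightarrow> 'a \<Rightarrow> ('a \<Rightarrow> 'a \<Rightarrow> real) \<Rightarrow> real" where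
  "flow_strength E r \<theta> = (\<Sum>w \<in> tree_children E r r. \<theta> r w)"

text \<open>
  For the edge \<open>e\<close> from \<open>v\<close> to its child \<open>w\<close>, the path from \<open>e\<close> to the root, including \<open>e\<close>, is the
  path from \<open>w\<close> to the root; hence the exponent \<open>|e|\<close> is the distance of \<open>w\<close> from \<open>r\<close>.
\<close>

definition flow_admissible :: "('a \<times> 'a) set \<Rightarrow> 'a \<Rightarrow> real \<Rightarrow> ('a \<Rightarrow> 'a \<Rightarrow> real) \<Rightarrow> bool" where
  "flow_admissible E r l \<theta> \<longleftrightarrow>
     (\<forall>v. \<forall>w \<in> tree_children E r v. \<theta> v w \<le> inverse l ^ graph_dist E r w)"

text \<open>
  The supremum is taken in the extended reals because the branching number of a locally finite
  tree with unbounded degrees can be infinite.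
\<close>

definition rooted_branching_number :: "'a set \<Rightarrow> ('a \<times> 'a) set \<Rightarrow> 'a \<Rightarrow> ereal" where
  "rooted_branching_number V E r =
     (if finite V then 0
      else Sup {ereal l | l. l \<ge> 1 \<and>
             (\<exists>\<theta>. root_flow E r \<theta> \<and> flow_admissible E r l \<theta> \<and> flow_strength E r \<theta> > 0)})"

text \<open>The value does not depend on the root, so an arbitrary one is chosen.\<close>

definition branching_number :: "'a set \<Rightarrow> ('a \<times> 'a) set \<Rightarrow> ereal" where
  "branching_number V E = rooted_branching_number V E (SOME r. r \<in> V)"

end

theory Submission
  imports Defs "HOL-Analysis.Convex"
begin

text \<open>
  Root the tree at \<open>x\<close>. Deleting at most \<open>k\<close> children (with everything below them) at each vertex
  that survives leaves a \<open>k\<close>-fort, since a surviving vertex keeps its parent; so the task is to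
  choose the deleted children.

  The choice is guided by the capacity \<open>c\<^sub>n(v)\<close>, which is the largest flow that can be sent from
  \<open>v\<close> through \<open>n\<close> further generations when the edges \<open>i\<close> generations below \<open>v\<close> carry at most
  \<open>l\<^sup>-\<^sup>i\<close> and \<open>v\<close> itself is entered by an edge of capacity \<open>1\<close>:
  \<open>c\<^sub>0(v) = 1\<close> and \<open>c\<^sub>n\<^sub>+\<^sub>1(v) = min 1 (\<Sum>w. c\<^sub>n(w) / l)\<close>, summed over the children \<open>w\<close> of \<open>v\<close>.
  It decreases in \<open>n\<close>, and a positive flow to infinity exists for \<open>l\<close> exactly if the limit at the
  root is positive: the limit bounds every flow (\<open>flow_le_capacity\<close>), and conversely dividing a flow
  among children in proportion to their limits respects all bounds (\<open>flow_of_lcap_pos\<close>). This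
  replaces the max-flow min-cut theorem. The branching numbers of the statement refer to arbitrary
  roots; positivity of the limit passes from a root to each neighbour
  (\<open>positive_capacity_any_root\<close>), hence the root is immaterial.

  Suppose \<open>br(T) < k + 1\<close>. For \<open>l = k + 1\<close> the limit is \<open>0\<close>, so \<open>c\<^sub>n(x) < 1\<close> for some \<open>n\<close>. If
  \<open>c\<^sub>j\<^sub>+\<^sub>1(v) < 1\<close>, the children of \<open>v\<close> have total \<open>c\<^sub>j\<close> less than \<open>k + 1\<close>, so at most \<open>k\<close> of them have
  \<open>c\<^sub>j = 1\<close>. Deleting these keeps the strict inequality at all surviving vertices, and because
  \<open>c\<^sub>0 = 1\<close> nothing survives in generation \<open>n\<close>: the fort is finite (\<open>finite_fort\<close>).

  Suppose \<open>br(T) = b \<ge> k + 1\<close>. Fix \<open>\<mu> > b\<close> and delete at each vertex the \<open>k\<close> children of largest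
  capacity. Then (\<open>sum_powr_without_largest\<close>)
  \<open>\<Sum>\<^bsub>surviving\<^esub> c\<^sup>p \<le> (\<mu> - k) * (\<Sum>\<^bsub>all\<^esub> c / \<mu>)\<^sup>p\<close> with \<open>p = \<mu> / (\<mu> - k)\<close>,
  so by induction the capacities of the fort for \<open>\<mu> - k\<close> are at most the \<open>p\<close>-th powers of those of
  the tree for \<open>\<mu>\<close>, and these tend to \<open>0\<close>. To serve all \<open>\<mu> > b\<close> with a single fort, the tree is cut
  into blocks of consecutive generations; block \<open>m\<close> uses \<open>\<mu> = b + 1 / (m + 1)\<close> and is so long that
  the total capacity at its first level is at most \<open>1 / (m + 1)\<close> (\<open>thin_fort\<close>).

  If \<open>br(T) = \<infinity>\<close>, the whole tree is a suitable fort.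
\<close>
section \<open>Distances in a rooted tree\<close>

lemma rtrancl_imp_distinct_path:
  assumes "(a, b) \<in> R\<^sup>*"
  shows "\<exists>xs. xs \<noteq> [] \<and> hd xs = a \<and> last xs = b \<and> distinct xs \<and> successively (\<lambda>u v. (u, v) \<in> R) xs"
  using assms
proof (induction rule: converse_rtrancl_induct)
  case base
  show ?case by (rule exI[of _ "[b]"]) simp
next
  case (step y z)
  then obtain xs where xs: "xs \<noteq> []" "hd xs = z" "last xs = b" "distinct xs"
    "successively (\<lambda>u v. (u, v) \<in> R) xs" by blast
  show ?case
  proof (cases "y \<in> set xs")
    case True
    then obtain ys zs where "xs = ys @ y # zs" by (meson split_list)
    then show ?thesis using xs
      by (intro exI[of _ "y # zs"]) (auto simp: successively_append_iff)
  next
    case False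
    then show ?thesis using xs step.hyps(1)
      by (intro exI[of _ "y # xs"]) (auto simp: successively_Cons)
  qed
qed

text \<open>A simple path from \<open>a\<close> to \<open>b\<close> that misses \<open>c\<close> would close up through \<open>c\<close> to a cycle.\<close>
lemma acyclic_neighbours_separated:
  assumes "simple_graph V E" and acyclic: "\<nexists>c. graph_cycle E c"
    and path: "(a, b) \<in> (E \<inter> (- {c}) \<times> (- {c}))\<^sup>*"
    and "a \<noteq> b" "(c, a) \<in> E" "(c, b) \<in> E"
  shows False
proof -
  have sym: "sym E" and irr: "irrefl E" using assms(1) by (auto simp: simple_graph_def)
  obtain xs where xs: "xs \<noteq> []" "hd xs = a" "last xs = b" "distinct xs"
    "successively (\<lambda>u v. (u, v) \<in> E \<inter> (- {c}) \<times> (- {c})) xs"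
    using rtrancl_imp_distinct_path[OF path] by blast
  have "c \<notin> set xs"
  proof -
    have "\<And>y. successively (\<lambda>u v. (u, v) \<in> E \<inter> (- {c}) \<times> (- {c})) (y # ys) \<Longrightarrow> y \<noteq> c
             \<Longrightarrow> c \<notin> set (y # ys)" for ys
      by (induction ys) auto
    moreover have "a \<noteq> c" using irr assms(5) by (auto simp: irrefl_def)
    ultimately show ?thesis using xs by (cases xs) auto
  qed
  moreover have "length xs \<ge> 2"
    using xs \<open>a \<noteq> b\<close> by (cases xs; cases "tl xs") auto
  moreover have "successively (\<lambda>u v. (u, v) \<in> E) xs"
    using xs(5) by (rule successively_mono) auto
  ultimately have "graph_cycle E (c # xs)"
    using xs assms(5,6) symD[OF sym, of c b]
    by (auto simp: graph_cycle_def successively_Cons)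
  then show False using acyclic by blast
qed

locale rooted_tree =
  fixes V :: "'a set" and E :: "('a \<times> 'a) set" and r :: 'a
  assumes tree: "graph_tree V E"
    and locally_finite: "locally_finite_graph V E"
    and root_in_V: "r \<in> V"
begin

abbreviation children :: "'a \<Rightarrow> 'a set" where "children \<equiv> tree_children E r"
abbreviation depth :: "'a \<Rightarrow> nat" where "depth \<equiv> graph_dist E r"

lemma simple: "simple_graph V E"
  using tree by (simp add: graph_tree_def)

lemma edge_sym: "(u, v) \<in> E \<Longrightarrow> (v, u) \<in> E"
  using simple by (auto simp: simple_graph_def sym_def)

lemma edge_in_V: "(u, v) \<in> E \<Longrightarrow> u \<in> V \<and> v \<in> V"
  using simple by (auto simp: simple_graph_def)

lemma no_loop: "(u, u) \<notin> E"
  using simple by (auto simp: simple_graph_def irrefl_def)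

lemma finite_neighbours: "finite {w. (v, w) \<in> E}"
proof (cases "v \<in> V")
  case False
  then have "{w. (v, w) \<in> E} = {}" using edge_in_V by blast
  then show ?thesis by simp
qed (use locally_finite in \<open>auto simp: locally_finite_graph_def\<close>)

lemma finite_children: "finite (children v)"
  by (rule finite_subset[OF _ finite_neighbours[of v]]) (auto simp: tree_children_def)

lemma children_in_V: "w \<in> children v \<Longrightarrow> w \<in> V"
  using edge_in_V by (auto simp: tree_children_def)

lemma child_depth: "w \<in> children v \<Longrightarrow> depth w = Suc (depth v)"
  by (simp add: tree_children_def)

lemma depth_path:
  assumes "v \<in> V" shows "(r, v) \<in> E ^^ depth v"
proof -
  have "(r, v) \<in> E\<^sup>*"
    using tree assms root_in_V by (auto simp: graph_tree_def graph_connected_def)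
  then obtain n where "(r, v) \<in> E ^^ n" by (meson rtrancl_imp_relpow)
  then show ?thesis unfolding graph_dist_def by (rule LeastI)
qed

lemma depth_le: "(r, v) \<in> E ^^ n \<Longrightarrow> depth v \<le> n"
  unfolding graph_dist_def by (rule Least_le)

lemma depth_root [simp]: "depth r = 0"
  using depth_le[of r 0] by simp

lemma depth_0_iff: "v \<in> V \<Longrightarrow> depth v = 0 \<longleftrightarrow> v = r"
  using depth_path[of v] by auto

lemma depth_edge: "(v, w) \<in> E \<Longrightarrow> depth w \<le> Suc (depth v)"
  by (rule depth_le) (use depth_path[of v] edge_in_V in auto)

lemma ex_parent:
  assumes "v \<in> V" "depth v = Suc n"
  obtains p where "p \<in> V" "v \<in> children p" "depth p = n"
proof -
  obtain p where p: "(r, p) \<in> E ^^ n" "(p, v) \<in> E"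
    using depth_path[OF assms(1)] assms(2) by auto
  have "depth p = n"
    using depth_le[OF p(1)] depth_edge[OF p(2)] assms(2) by simp
  then show ?thesis
    using that[of p] p assms(2) edge_in_V by (auto simp: tree_children_def)
qed

text \<open>All vertices before \<open>v\<close> on a shortest path from the root are strictly closer to the root than
  \<open>c\<close>.\<close>
lemma path_from_root_avoiding:
  assumes "v \<in> V" "depth v \<le> depth c" "v \<noteq> c"
  shows "(r, v) \<in> (E \<inter> (- {c}) \<times> (- {c}))\<^sup>*"
  using assms
proof (induction "depth v" arbitrary: v)
  case 0
  then show ?case using depth_0_iff by auto
next
  case (Suc n)
  obtain p where p: "p \<in> V" "v \<in> children p" "depth p = n"
    using ex_parent[OF Suc.prems(1)] Suc.hyps(2) by metis
  then have "p \<noteq> c" using Suc.hyps(2) Suc.prems(2) by auto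
  then have "(r, p) \<in> (E \<inter> (- {c}) \<times> (- {c}))\<^sup>*"
    using Suc.hyps(1)[of p] p Suc.hyps(2) Suc.prems(2) by simp
  moreover have "(p, v) \<in> E \<inter> (- {c}) \<times> (- {c})"
    using p(2) \<open>p \<noteq> c\<close> Suc.prems(3) by (simp add: tree_children_def)
  ultimately show ?case by (rule rtrancl_into_rtrancl)
qed

text \<open>Two such neighbours would be joined through the root without passing through \<open>v\<close>, which
  closes a cycle at \<open>v\<close>.\<close>
lemma neighbour_towards_root_unique:
  assumes "(v, a) \<in> E" "(v, b) \<in> E" "depth a \<le> depth v" "depth b \<le> depth v"
  shows "a = b"
proof (rule ccontr)
  let ?R = "E \<inter> (- {v}) \<times> (- {v})"
  assume "a \<noteq> b"
  have V: "a \<in> V" "b \<in> V" and ne: "a \<noteq> v" "b \<noteq> v"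
    using assms edge_in_V no_loop by auto
  have ra: "(r, a) \<in> ?R\<^sup>*" and rb: "(r, b) \<in> ?R\<^sup>*"
    using path_from_root_avoiding V ne assms by auto
  have "sym ?R" by (auto simp: sym_def intro: edge_sym)
  then have "(a, r) \<in> ?R\<^sup>*" using ra by (meson sym_rtrancl symD)
  then have "(a, b) \<in> ?R\<^sup>*" using rb by (rule rtrancl_trans)
  then show False
    using acyclic_neighbours_separated[OF simple _ _ \<open>a \<noteq> b\<close> assms(1,2)] tree
    by (auto simp: graph_tree_def)
qed

lemma children_root: "children r = {w. (r, w) \<in> E}"
proof -
  have "depth w = Suc 0" if "(r, w) \<in> E" for w
    using depth_edge[OF that] depth_0_iff[of w] no_loop edge_in_V that by (cases "depth w") auto
  then show ?thesis by (auto simp: tree_children_def)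
qed

text \<open>Seen from \<open>w\<close>, the parent is the only neighbour that is not farther from the root. Hence the
  children can be described without distances, which makes them comparable for different roots and
  for subtrees.\<close>
lemma children_of_child:
  assumes "w \<in> children v"
  shows "children w = {u. (w, u) \<in> E} - {v}"
proof -
  have vw: "(w, v) \<in> E" "depth w = Suc (depth v)"
    using assms edge_sym by (auto simp: tree_children_def)
  have "depth u = Suc (depth w)" if "(w, u) \<in> E" "u \<noteq> v" for u
    using neighbour_towards_root_unique[OF that(1) vw(1)] vw(2) depth_edge[OF that(1)] that(2)
    by (metis le_SucE le_SucI nle_le)
  then show ?thesis using vw by (auto simp: tree_children_def)
qed

lemma parent_unique:
  assumes "w \<in> children u" "w \<in> children v" shows "u = v"
proof (rule neighbour_towards_root_unique)
  show "(w, u) \<in> E" "(w, v) \<in> E"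
    using assms by (auto simp: tree_children_def intro: edge_sym)
qed (use child_depth[OF assms(1)] child_depth[OF assms(2)] in simp_all)

lemma child_not_root: "r \<notin> children v"
  by (auto simp: tree_children_def)

lemma level_0: "{v \<in> V. depth v = 0} = {r}"
  using depth_0_iff root_in_V by auto

lemma level_Suc: "{v \<in> V. depth v = Suc n} = (\<Union>v\<in>{v \<in> V. depth v = n}. children v)"
proof (intro equalityI subsetI)
  fix v assume "v \<in> {v \<in> V. depth v = Suc n}"
  then show "v \<in> (\<Union>v\<in>{v \<in> V. depth v = n}. children v)"
    using ex_parent[of v n] by blast
qed (auto simp: children_in_V child_depth)

lemma finite_level: "finite {v \<in> V. depth v = n}"
proof (induction n)
  case (Suc n)
  then show ?case unfolding level_Suc using finite_children by blast
qed (simp only: level_0, simp)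

lemma root_descendant_induct [consumes 1, case_names root child]:
  assumes "v \<in> V" "P r" "\<And>v w. v \<in> V \<Longrightarrow> P v \<Longrightarrow> w \<in> children v \<Longrightarrow> P w"
  shows "P v"
  using assms(1)
proof (induction "depth v" arbitrary: v)
  case 0
  then show ?case using depth_0_iff assms(2) by auto
next
  case (Suc n)
  obtain p where "p \<in> V" "v \<in> children p" "depth p = n"
    using ex_parent[OF Suc.prems] Suc.hyps(2) by metis
  then show ?case using Suc.hyps(1)[of p] assms(3) by auto
qed

end

section \<open>Capacities and flows\<close>

text \<open>
  The maximal flow through \<open>n\<close> generations below \<open>v\<close>, measured in units of the capacity of the edge
  that enters \<open>v\<close>; each generation scales the edge capacities by \<open>1 / l\<close>. The successor function \<open>ch\<close>
  is a parameter so that the same notion applies to the vertices of a rooted tree, to those of a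
  fort, and to directed edges.
\<close>
primrec capacity :: "('b \<Rightarrow> 'b set) \<Rightarrow> real \<Rightarrow> nat \<Rightarrow> 'b \<Rightarrow> real" where
  "capacity ch l 0 v = 1"
| "capacity ch l (Suc n) v = min 1 ((\<Sum>w\<in>ch v. capacity ch l n w) / l)"

definition limit_capacity :: "('b \<Rightarrow> 'b set) \<Rightarrow> real \<Rightarrow> 'b \<Rightarrow> real" where
  "limit_capacity ch l v = lim (\<lambda>n. capacity ch l n v)"

lemma capacity_nonneg: "0 < l \<Longrightarrow> 0 \<le> capacity ch l n v"
  by (induction n arbitrary: v) (auto intro!: divide_nonneg_pos sum_nonneg)

lemma capacity_le_1: "capacity ch l n v \<le> 1"
  by (cases n) auto

lemma capacity_Suc_le:
  assumes "0 < l" shows "capacity ch l (Suc n) v \<le> capacity ch l n v"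
proof (induction n arbitrary: v)
  case (Suc n)
  have "(\<Sum>w\<in>ch v. capacity ch l (Suc n) w) / l \<le> (\<Sum>w\<in>ch v. capacity ch l n w) / l"
    using assms Suc by (intro divide_right_mono sum_mono) auto
  then show ?case unfolding capacity.simps(2)[of ch l _ v] by (meson min.mono order_refl)
qed simp

lemma capacity_tendsto:
  assumes "0 < l" shows "(\<lambda>n. capacity ch l n v) \<longlonglongrightarrow> limit_capacity ch l v"
proof -
  have "decseq (\<lambda>n. capacity ch l n v)"
    using capacity_Suc_le[OF assms] by (rule decseq_SucI)
  then obtain L where "(\<lambda>n. capacity ch l n v) \<longlonglongrightarrow> L"
    using decseq_convergent[of _ 0] capacity_nonneg[OF assms] by metis
  then show ?thesis unfolding limit_capacity_def by (simp add: limI)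
qed

lemma limit_capacity_le:
  assumes "0 < l" shows "limit_capacity ch l v \<le> capacity ch l n v"
proof (rule decseq_ge[OF _ capacity_tendsto[OF assms]])
  show "decseq (\<lambda>n. capacity ch l n v)" using capacity_Suc_le[OF assms] by (rule decseq_SucI)
qed

lemma limit_capacity_nonneg: "0 < l \<Longrightarrow> 0 \<le> limit_capacity ch l v"
  by (rule LIMSEQ_le_const[OF capacity_tendsto]) (auto intro: capacity_nonneg)

lemma limit_capacity_unfold:
  assumes "0 < l"
  shows "limit_capacity ch l v = min 1 ((\<Sum>w\<in>ch v. limit_capacity ch l w) / l)"
proof (rule LIMSEQ_unique)
  show "(\<lambda>n. capacity ch l (Suc n) v) \<longlonglongrightarrow> limit_capacity ch l v"
    using capacity_tendsto[OF assms] by (rule LIMSEQ_Suc)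
  show "(\<lambda>n. capacity ch l (Suc n) v) \<longlonglongrightarrow> min 1 ((\<Sum>w\<in>ch v. limit_capacity ch l w) / l)"
    unfolding capacity.simps using assms
    by (intro tendsto_min tendsto_const tendsto_divide tendsto_sum capacity_tendsto) auto
qed

lemma limit_capacity_pos_iff:
  assumes "0 < l" "finite (ch v)"
  shows "limit_capacity ch l v > 0 \<longleftrightarrow> (\<exists>w\<in>ch v. limit_capacity ch l w > 0)"
proof -
  have "limit_capacity ch l v > 0 \<longleftrightarrow> (\<Sum>w\<in>ch v. limit_capacity ch l w) > 0"
    using limit_capacity_unfold[OF assms(1), of ch v] assms(1) by (auto simp: zero_less_divide_iff)
  also have "\<dots> \<longleftrightarrow> (\<exists>w\<in>ch v. limit_capacity ch l w > 0)"
    using sum_nonneg_eq_0_iff[OF assms(2), of "limit_capacity ch l"]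
      sum_nonneg[of "ch v" "limit_capacity ch l"] limit_capacity_nonneg[OF assms(1)]
    by (metis less_eq_real_def less_irrefl)
  finally show ?thesis .
qed

context rooted_tree
begin

abbreviation lcap :: "real \<Rightarrow> 'a \<Rightarrow> real" where "lcap \<equiv> limit_capacity children"

lemma lcap_eq_0:
  assumes "0 < l" "lcap l r = 0" "v \<in> V" shows "lcap l v = 0"
  using assms(3)
proof (induction rule: root_descendant_induct)
  case (child v w)
  then have "\<not> lcap l v > 0" by simp
  then have "\<not> lcap l w > 0"
    using limit_capacity_pos_iff[where ch = children, OF assms(1) finite_children] child.hyps by blast
  then show ?case using limit_capacity_nonneg[OF assms(1), of children w] by linarith
qed (rule assms(2))

text \<open>The flow through an edge is bounded by the capacity of that edge, and by conservation also by
  the bounds on the edges below it; iterating \<open>n\<close> times gives the capacity.\<close>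
lemma flow_le_capacity:
  assumes "root_flow E r \<theta>" "flow_admissible E r l \<theta>" "0 < l" "w \<in> children v"
  shows "\<theta> v w \<le> inverse l ^ depth w * capacity children l n w"
  using assms(4)
proof (induction n arbitrary: v w)
  case 0
  then show ?case using assms(2) by (auto simp: flow_admissible_def)
next
  case (Suc n)
  have "\<theta> v w = (\<Sum>u\<in>children w. \<theta> w u)"
    using assms(1) Suc.prems by (auto simp: root_flow_def)
  also have "\<dots> \<le> (\<Sum>u\<in>children w. inverse l ^ Suc (depth w) * capacity children l n u)"
    using Suc.IH child_depth by (intro sum_mono) metis
  also have "\<dots> = inverse l ^ depth w * ((\<Sum>u\<in>children w. capacity children l n u) / l)"
    by (simp add: sum_distrib_left sum_divide_distrib field_simps)
  finally have "\<theta> v w \<le> inverse l ^ depth w * ((\<Sum>u\<in>children w. capacity children l n u) / l)" .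
  moreover have "\<theta> v w \<le> inverse l ^ depth w"
    using assms(2) Suc.prems by (auto simp: flow_admissible_def)
  ultimately show ?case by (simp add: min_def)
qed

lemma lcap_pos_of_flow:
  assumes "root_flow E r \<theta>" "flow_admissible E r l \<theta>" "0 < l" "flow_strength E r \<theta> > 0"
  shows "lcap l r > 0"
proof -
  obtain w where w: "w \<in> children r" "\<theta> r w > 0"
    using assms(4) unfolding flow_strength_def by (meson not_less sum_nonpos)
  have "\<theta> r w \<le> inverse l ^ depth w * lcap l w"
    by (rule LIMSEQ_le_const[OF tendsto_mult[OF tendsto_const capacity_tendsto[OF assms(3)]]])
      (use flow_le_capacity[OF assms(1,2,3) w(1)] in auto)
  then have "lcap l w > 0"
    using w(2) assms(3) by (smt (verit) mult_nonneg_nonpos zero_less_power positive_imp_inverse_positive)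
  then show ?thesis using limit_capacity_pos_iff[where ch = children, OF assms(3) finite_children] w(1) by blast
qed

definition parent :: "'a \<Rightarrow> 'a" where "parent w = (THE v. w \<in> children v)"

lemma parent_eq: "w \<in> children v \<Longrightarrow> parent w = v"
  unfolding parent_def using parent_unique by blast

text \<open>The amount that reaches a vertex of depth \<open>n\<close> if \<open>lcap l r\<close> enters at the root and every vertex
  divides what it receives among its children in proportion to their limit capacities.\<close>
primrec split_amount :: "real \<Rightarrow> nat \<Rightarrow> 'a \<Rightarrow> real" where
  "split_amount l 0 v = lcap l r"
| "split_amount l (Suc n) v =
     split_amount l n (parent v) * (lcap l v / (\<Sum>u\<in>children (parent v). lcap l u))"

text \<open>
  Proportional division sends \<open>\<Theta> v * lcap l w / S v\<close> from \<open>v\<close> to its child \<open>w\<close>, where \<open>S v\<close> is the sum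
  of the limit capacities of the children. Since \<open>lcap l v \<le> S v / l\<close>, a bound of \<open>\<Theta> v\<close> by
  \<open>l\<^sup>-\<^sup>d * lcap l v\<close> at depth \<open>d\<close> is inherited by the children with \<open>d + 1\<close> in place of \<open>d\<close>.
\<close>
lemma flow_of_lcap_pos:
  assumes "lcap l r > 0" "0 < l"
  shows "\<exists>\<theta>. root_flow E r \<theta> \<and> flow_admissible E r l \<theta> \<and> flow_strength E r \<theta> > 0"
proof -
  define \<Theta> where "\<Theta> w = split_amount l (depth w) w" for w
  define S where "S v = (\<Sum>u\<in>children v. lcap l u)" for v
  have nn: "lcap l v \<ge> 0" for v using limit_capacity_nonneg[OF assms(2)] .
  have S: "S v \<ge> 0" for v unfolding S_def using nn by (intro sum_nonneg) auto
  have lcap_le_S: "lcap l v \<le> S v / l" for v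
    using limit_capacity_unfold[OF assms(2), of children v] unfolding S_def by linarith
  have \<Theta>_child: "\<Theta> w = \<Theta> v * (lcap l w / S v)" if "w \<in> children v" for v w
    using that unfolding \<Theta>_def S_def by (simp add: child_depth parent_eq)
  have bound: "0 \<le> \<Theta> v \<and> \<Theta> v \<le> inverse l ^ depth v * lcap l v" if "v \<in> V" for v
    using that
  proof (induction rule: root_descendant_induct)
    case root
    then show ?case using assms(1) by (simp add: \<Theta>_def)
  next
    case (child v w)
    have "inverse l ^ depth v * lcap l v \<le> inverse l ^ depth v * (S v / l)"
      using lcap_le_S assms(2) by (intro mult_left_mono) auto
    then have "\<Theta> v * (lcap l w / S v) \<le> (inverse l ^ depth v * (S v / l)) * (lcap l w / S v)"
      using child.IH nn[of w] S[of v] by (intro mult_right_mono) auto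
    also have "\<dots> \<le> inverse l ^ Suc (depth v) * lcap l w"
      using assms(2) nn[of w] by (cases "S v = 0") (auto simp: field_simps)
    finally show ?case
      using child S nn by (simp add: \<Theta>_child child_depth)
  qed
  have conserve: "\<Theta> v = (\<Sum>u\<in>children v. \<Theta> u)" if "v \<in> V" for v
  proof (cases "S v = 0")
    case True
    \<comment> \<open>The quotients \<open>lcap l w / S v\<close> have the default value \<open>0\<close> here, but nothing reaches \<open>v\<close>.\<close>
    then have "lcap l v = 0" using lcap_le_S[of v] nn[of v] by simp
    then have "\<Theta> v = 0" using bound[OF that] by simp
    then show ?thesis by (simp add: \<Theta>_child)
  next
    case False
    have "(\<Sum>u\<in>children v. \<Theta> u) = \<Theta> v * (S v / S v)"
      unfolding S_def[of v] sum_divide_distrib sum_distrib_left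
      by (rule sum.cong) (simp_all add: \<Theta>_child S_def)
    then show ?thesis using False by simp
  qed
  have lcap_le_1: "lcap l v \<le> 1" for v
    using limit_capacity_le[OF assms(2), of children v 0] by simp
  have "\<Theta> w \<le> inverse l ^ depth w" if "w \<in> V" for w
    using bound[OF that] lcap_le_1[of w] assms(2)
    by (smt (verit, best) mult_left_le zero_less_power positive_imp_inverse_positive)
  then have "flow_admissible E r l (\<lambda>v. \<Theta>)"
    using children_in_V by (auto simp: flow_admissible_def)
  moreover have "root_flow E r (\<lambda>v. \<Theta>)"
    using bound conserve children_in_V by (auto simp: root_flow_def)
  moreover have "flow_strength E r (\<lambda>v. \<Theta>) > 0"
    using conserve[OF root_in_V] assms(1) by (simp add: flow_strength_def \<Theta>_def)
  ultimately show ?thesis by blast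
qed

end


section \<open>Independence of the root\<close>

text \<open>The edges that can follow the directed edge \<open>e\<close> on a path that does not turn back. A directed
  edge stands for the branch that it leads into; this branch is the same for every root behind the
  edge.\<close>
definition onward :: "('a \<times> 'a) set \<Rightarrow> 'a \<times> 'a \<Rightarrow> ('a \<times> 'a) set" where
  "onward E e = E \<inter> {snd e} \<times> (- {fst e})"

lemma (in rooted_tree) capacity_onward:
  assumes "w \<in> children v"
  shows "capacity (onward E) l n (v, w) = capacity children l n w"
  using assms
proof (induction n arbitrary: v w)
  case (Suc n)
  have "onward E (v, w) = Pair w ` children w"
    using children_of_child[OF Suc.prems] by (auto simp: onward_def)
  then have "(\<Sum>e\<in>onward E (v, w). capacity (onward E) l n e) = (\<Sum>u\<in>children w. capacity children l n u)"
    using Suc.IH by (simp add: sum.reindex inj_on_def)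
  then show ?case by simp
qed simp

lemma (in rooted_tree) lcap_root_pos_iff:
  assumes "0 < l"
  shows "lcap l r > 0 \<longleftrightarrow> (\<exists>w. (r, w) \<in> E \<and> limit_capacity (onward E) l (r, w) > 0)"
proof -
  have "limit_capacity (onward E) l (r, w) = lcap l w" if "w \<in> children r" for w
    unfolding limit_capacity_def using capacity_onward[OF that] by simp
  then show ?thesis
    using limit_capacity_pos_iff[where ch = children, OF assms finite_children, of r] children_root
    by auto
qed

text \<open>
  Positivity at a root \<open>u\<close> means that some edge leaving \<open>u\<close> leads into a branch of positive limit
  capacity. For a neighbour \<open>v\<close> of \<open>u\<close> the same holds: if the edge is \<open>(u, v)\<close>, it has a
  continuation \<open>(v, y)\<close> of positive limit capacity; otherwise it continues the edge \<open>(v, u)\<close>, which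
  therefore has positive limit capacity.
\<close>
lemma positive_capacity_any_root:
  assumes "rooted_tree V E r" "s \<in> V" "0 < l"
    and "limit_capacity (tree_children E r) l r > 0"
  shows "limit_capacity (tree_children E s) l s > 0"
proof -
  interpret R: rooted_tree V E r by fact
  interpret S: rooted_tree V E s
    using R.tree R.locally_finite assms(2) by unfold_locales
  let ?c = "limit_capacity (onward E) l"
  have fin: "finite (onward E e)" for e
    by (rule finite_subset[of _ "Pair (snd e) ` {w. (snd e, w) \<in> E}"])
      (auto simp: onward_def R.finite_neighbours)
  have "(r, s) \<in> E\<^sup>*"
    using R.tree assms(2) R.root_in_V by (auto simp: graph_tree_def graph_connected_def)
  then have "\<exists>w. (s, w) \<in> E \<and> ?c (s, w) > 0"
  proof (induction rule: rtrancl_induct)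
    case base
    show ?case using R.lcap_root_pos_iff assms(3,4) by simp
  next
    case (step u v)
    then obtain w where w: "(u, w) \<in> E" "?c (u, w) > 0" by blast
    have vu: "(v, u) \<in> E" using step R.edge_sym by blast
    show ?case
    proof (cases "w = v")
      case True
      then obtain e where e: "e \<in> onward E (u, v)" "?c e > 0"
        using limit_capacity_pos_iff[where ch = "onward E", OF assms(3) fin, of "(u, v)"] w by auto
      then have "e \<in> E" "e = (v, snd e)" by (auto simp: onward_def)
      then show ?thesis using e(2) by metis
    next
      case False
      then have "(u, w) \<in> onward E (v, u)" using w by (simp add: onward_def)
      then have "?c (v, u) > 0"
        using limit_capacity_pos_iff[where ch = "onward E", OF assms(3) fin, of "(v, u)"] w by blast
      then show ?thesis using vu by blast
    qed
  qed
  then show ?thesis using S.lcap_root_pos_iff assms(3) by simp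
qed

context rooted_tree
begin

lemma rooted_tree_some_root: "rooted_tree V E (SOME s. s \<in> V)"
  using tree locally_finite root_in_V by unfold_locales (auto intro: someI)

lemma lcap_eq_0_above_branching_number:
  assumes "infinite V" "1 \<le> l" "branching_number V E < ereal l"
  shows "lcap l r = 0"
proof (rule ccontr)
  define s where "s = (SOME s. s \<in> V)"
  interpret S: rooted_tree V E s unfolding s_def by (rule rooted_tree_some_root)
  assume "lcap l r \<noteq> 0"
  then have "lcap l r > 0"
    using limit_capacity_nonneg[of l children r] assms(2) by simp
  then have "S.lcap l s > 0"
    using positive_capacity_any_root[OF rooted_tree_axioms S.root_in_V] assms(2) by simp
  then have "\<exists>\<theta>. root_flow E s \<theta> \<and> flow_admissible E s l \<theta> \<and> flow_strength E s \<theta> > 0"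
    using S.flow_of_lcap_pos assms(2) by simp
  then have "ereal l \<le> branching_number V E"
    unfolding branching_number_def rooted_branching_number_def s_def[symmetric]
    using assms(1,2) by (auto intro!: Sup_upper)
  then show False using assms(3) by simp
qed

lemma branching_number_le:
  assumes "infinite V" "\<And>l. 1 \<le> l \<Longrightarrow> lcap l r > 0 \<Longrightarrow> ereal l \<le> B"
  shows "branching_number V E \<le> B"
proof -
  define s where "s = (SOME s. s \<in> V)"
  interpret S: rooted_tree V E s unfolding s_def by (rule rooted_tree_some_root)
  have "ereal l \<le> B"
    if "1 \<le> l" "root_flow E s \<theta>" "flow_admissible E s l \<theta>" "flow_strength E s \<theta> > 0" for l \<theta>
  proof -
    have "S.lcap l s > 0" using S.lcap_pos_of_flow[OF that(2,3) _ that(4)] that(1) by simp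
    then show ?thesis
      using positive_capacity_any_root[OF S.rooted_tree_axioms root_in_V] assms(2) that(1) by simp
  qed
  then show ?thesis
    unfolding branching_number_def rooted_branching_number_def s_def[symmetric]
    using assms(1) by (auto intro!: Sup_least)
qed

end

section \<open>Forts obtained by deleting children\<close>

context rooted_tree
begin

text \<open>What remains when, for every remaining vertex \<open>v\<close>, the children in \<open>D v\<close> are cut off together
  with all their descendants.\<close>
inductive_set pruned :: "('a \<Rightarrow> 'a set) \<Rightarrow> 'a set" for D where
  root: "r \<in> pruned D"
| child: "v \<in> pruned D \<Longrightarrow> w \<in> children v \<Longrightarrow> w \<notin> D v \<Longrightarrow> w \<in> pruned D"

lemma pruned_subset: "v \<in> pruned D \<Longrightarrow> v \<in> V"
  by (induction rule: pruned.induct) (auto simp: root_in_V children_in_V)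

lemma children_in_pruned:
  assumes "v \<in> pruned D" shows "children v \<inter> pruned D = children v - D v"
proof (intro equalityI subsetI)
  fix w assume w: "w \<in> children v \<inter> pruned D"
  then have "w \<in> pruned D" by simp
  then show "w \<in> children v - D v"
    using w by cases (use child_not_root parent_unique in blast)+
qed (use assms pruned.child in blast)

text \<open>A neighbour of \<open>v\<close> is a child or the parent, and the parent of a remaining vertex remains.\<close>
lemma neighbour_in_pruned:
  assumes "v \<in> pruned D" "(v, w) \<in> E" "w \<notin> D v" shows "w \<in> pruned D"
proof (cases "w \<in> children v")
  case True
  then show ?thesis using assms pruned.child by blast
next
  case False
  from assms(1) show ?thesis
  proof cases
    case root
    then show ?thesis using False children_root assms(2) by blast
  next
    case (child p)
    then show ?thesis using children_of_child[of v p] False assms(2) by blast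
  qed
qed

lemma pruned_connected: "graph_connected (pruned D) (induced_edges E (pruned D))"
proof -
  let ?R = "induced_edges E (pruned D)"
  have sym: "sym (?R\<^sup>*)"
    by (rule sym_rtrancl) (auto simp: sym_def induced_edges_def intro: edge_sym)
  have "(r, v) \<in> ?R\<^sup>*" if "v \<in> pruned D" for v
    using that
  proof (induction rule: pruned.induct)
    case (child v w)
    then have "(v, w) \<in> ?R"
      using pruned.child by (auto simp: induced_edges_def tree_children_def)
    then show ?case using child.IH by simp
  qed simp
  then show ?thesis
    unfolding graph_connected_def using sym by (meson symD rtrancl_trans)
qed

lemma pruned_fort:
  assumes "\<And>v. v \<in> pruned D \<Longrightarrow> D v \<subseteq> children v \<and> card (D v) \<le> k"
  shows "k_fort k V E (pruned D)"
proof -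
  have "finite {w \<in> V - pruned D. (v, w) \<in> E} \<and> card {w \<in> V - pruned D. (v, w) \<in> E} \<le> k"
    if v: "v \<in> pruned D" for v
  proof -
    have sub: "{w \<in> V - pruned D. (v, w) \<in> E} \<subseteq> D v"
      using neighbour_in_pruned[OF v] by blast
    have fin: "finite (D v)" using assms[OF v] finite_children finite_subset by blast
    show ?thesis
      using finite_subset[OF sub fin] card_mono[OF fin sub] assms[OF v] by simp
  qed
  then show ?thesis
    unfolding k_fort_def using pruned_subset pruned_connected pruned.root by blast
qed

lemma pruned_rooted_tree: "rooted_tree (pruned D) (induced_edges E (pruned D)) r"
proof
  have "graph_cycle (induced_edges E (pruned D)) c \<Longrightarrow> graph_cycle E c" for c
    unfolding graph_cycle_def induced_edges_def by (auto elim!: successively_mono)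
  then show "graph_tree (pruned D) (induced_edges E (pruned D))"
    using tree pruned_connected[of D] pruned.root[of D]
    by (auto simp: graph_tree_def simple_graph_def induced_edges_def sym_def irrefl_def)
  show "locally_finite_graph (pruned D) (induced_edges E (pruned D))"
    unfolding locally_finite_graph_def induced_edges_def
    using finite_neighbours by (auto intro: finite_subset[rotated])
qed (rule pruned.root)

lemma pruned_children:
  assumes "v \<in> pruned D"
  shows "tree_children (induced_edges E (pruned D)) r v = children v - D v"
proof -
  interpret P: rooted_tree "pruned D" "induced_edges E (pruned D)" r by (rule pruned_rooted_tree)
  have "P.children v = children v \<inter> pruned D"
    using assms
  proof (induction rule: pruned.induct)
    case root
    then show ?case
      using P.children_root children_root pruned.root by (auto simp: induced_edges_def)
  next
    case (child v w)
    then have w: "w \<in> pruned D" "w \<in> P.children v"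
      using pruned.child by blast+
    then show ?case
      using P.children_of_child[OF w(2)] children_of_child[OF child.hyps(2)]
      by (auto simp: induced_edges_def)
  qed
  then show ?thesis using children_in_pruned[OF assms] by simp
qed

lemma pruned_depth:
  assumes "v \<in> pruned D"
  shows "graph_dist (induced_edges E (pruned D)) r v = depth v"
  using assms
proof (induction rule: pruned.induct)
  case root
  interpret P: rooted_tree "pruned D" "induced_edges E (pruned D)" r by (rule pruned_rooted_tree)
  show ?case by simp
next
  case (child v w)
  interpret P: rooted_tree "pruned D" "induced_edges E (pruned D)" r by (rule pruned_rooted_tree)
  have "w \<in> P.children v" using pruned_children[OF child.hyps(1)] child by blast
  then show ?case using P.child_depth child child_depth by simp
qed

section \<open>Finite forts\<close>

text \<open>
  With \<open>l = k + 1\<close>, a vertex whose capacity \<open>c (Suc j) v\<close> is less than \<open>1\<close> has at most \<open>k\<close> children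
  with \<open>c j w = 1\<close>. Deleting exactly these propagates the strict inequality downwards until it
  would contradict \<open>c 0 w = 1\<close>.
\<close>
lemma finite_fort:
  assumes "lcap (real k + 1) r = 0"
  shows "\<exists>F. r \<in> F \<and> k_fort k V E F \<and> finite F"
proof -
  define c where "c = capacity children (real k + 1)"
  have "(\<lambda>n. c n r) \<longlonglongrightarrow> 0"
    using capacity_tendsto[of "real k + 1" children r] assms unfolding c_def by simp
  then have "\<forall>\<^sub>F n in sequentially. c n r < 1"
    by (rule order_tendstoD) simp
  then obtain n where n: "c n r < 1" by (auto simp: eventually_sequentially)
  define D where "D v = {w \<in> children v. c (n - Suc (depth v)) w = 1}" for v
  have low: "depth v < n \<and> c (n - depth v) v < 1" if "v \<in> pruned D" for v
    using that
  proof (induction rule: pruned.induct)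
    case root
    then show ?case using n by (cases n) (auto simp: c_def)
  next
    case (child v w)
    have "c (n - depth w) w < 1"
      using child.hyps capacity_le_1[of children "real k + 1" _ w]
      by (auto simp: D_def c_def child_depth less_le)
    moreover from this have "n - depth w \<noteq> 0" unfolding c_def by (metis capacity.simps(1) less_irrefl)
    ultimately show ?case by simp
  qed
  have "card (D v) \<le> k" if v: "v \<in> pruned D" for v
  proof -
    define j where "j = n - Suc (depth v)"
    have "n - depth v = Suc j" using low[OF v] unfolding j_def by linarith
    then have "(\<Sum>w\<in>children v. c j w) < real k + 1"
      using low[OF v] by (auto simp: c_def min_def field_simps split: if_splits)
    moreover have "(\<Sum>w\<in>D v. c j w) \<le> (\<Sum>w\<in>children v. c j w)"
      by (rule sum_mono2) (auto simp: finite_children D_def c_def intro: capacity_nonneg)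
    moreover have "(\<Sum>w\<in>D v. c j w) = real (card (D v))"
      by (simp add: D_def j_def)
    ultimately show ?thesis by linarith
  qed
  then have "k_fort k V E (pruned D)"
    by (intro pruned_fort) (auto simp: D_def)
  moreover have "finite (pruned D)"
  proof (rule finite_subset)
    show "pruned D \<subseteq> (\<Union>m<n. {v \<in> V. depth v = m})"
      using low pruned_subset by blast
  qed (auto intro: finite_level)
  ultimately show ?thesis using pruned.root by blast
qed

end

section \<open>Deleting the largest capacities\<close>

lemma ex_largest_elements:
  fixes g :: "'b \<Rightarrow> real"
  assumes "finite A"
  shows "\<exists>D\<subseteq>A. card D \<le> k \<and> (D = A \<or> card D = k \<and> (\<forall>a\<in>A - D. \<forall>d\<in>D. g a \<le> g d))"
proof (induction k)
  case 0
  show ?case by (rule exI[of _ "{}"]) simp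
next
  case (Suc k)
  then obtain D where D: "D \<subseteq> A" "card D \<le> k"
    "D = A \<or> card D = k \<and> (\<forall>a\<in>A - D. \<forall>d\<in>D. g a \<le> g d)" by blast
  show ?case
  proof (cases "D = A")
    case True
    then show ?thesis using D(2) by (intro exI[of _ D]) auto
  next
    case False
    then have ne: "A - D \<noteq> {}" and fin: "finite (A - D)" using D(1) assms by auto
    then have "Max (g ` (A - D)) \<in> g ` (A - D)" by (intro Max_in) auto
    then obtain a where a: "a \<in> A - D" "g a = Max (g ` (A - D))" by auto
    have "g b \<le> g a" if "b \<in> A - D" for b
      using a(2) Max_ge[of "g ` (A - D)" "g b"] fin that by simp
    moreover have "card (insert a D) = Suc k"
      using a(1) D False assms by (simp add: finite_subset)
    ultimately show ?thesis
      using a(1) D False by (intro exI[of _ "insert a D"]) auto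
  qed
qed

text \<open>
  Let \<open>p = \<mu> / (\<mu> - k)\<close>, let \<open>t\<close> be the smallest deleted value, assumed positive, \<open>R\<close> the sum of
  the others, and let \<open>n = R / t\<close>. Convexity makes \<open>n\<close> equal values \<open>t\<close> the worst case, so the left
  side is at most
  \<open>n * t\<^sup>p\<close>, while the right side is at least \<open>(\<mu> - k) * ((n + k) / \<mu>)\<^sup>p * t\<^sup>p\<close>. As a function of
  \<open>n\<close>, the convex factor \<open>(\<mu> - k) * ((n + k) / \<mu>)\<^sup>p\<close> has the tangent \<open>n\<close> at \<open>n = \<mu> - k\<close>; the value
  of \<open>p\<close> is dictated by this tangency.
\<close>
lemma sum_powr_without_largest:
  fixes g :: "'b \<Rightarrow> real" and \<mu> :: real
  assumes fin: "finite A" and nn: "\<And>a. a \<in> A \<Longrightarrow> 0 \<le> g a"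
    and D: "D \<subseteq> A" "card D = k" "\<And>a d. a \<in> A - D \<Longrightarrow> d \<in> D \<Longrightarrow> g a \<le> g d"
    and k: "1 \<le> k" "real k < \<mu>"
  shows "(\<Sum>a\<in>A - D. g a powr (\<mu> / (\<mu> - k))) \<le> (\<mu> - k) * ((\<Sum>a\<in>A. g a) / \<mu>) powr (\<mu> / (\<mu> - k))"
proof -
  define p where "p = \<mu> / (\<mu> - k)"
  define t where "t = Min (g ` D)"
  define R where "R = (\<Sum>a\<in>A - D. g a)"
  have finD: "finite D" and "D \<noteq> {}" using D(1,2) fin k(1) finite_subset by auto
  then have "t \<in> g ` D" unfolding t_def by (intro Min_in) auto
  then have t_ge: "g a \<le> t" if "a \<in> A - D" for a using D(3)[OF that] by auto
  have t_le: "t \<le> g d" if "d \<in> D" for d using finD that by (simp add: t_def)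
  have t0: "0 \<le> t" using \<open>t \<in> g ` D\<close> nn D(1) by auto
  have p: "p > 1" using k by (simp add: p_def)
  have R0: "R \<ge> 0" unfolding R_def using nn by (intro sum_nonneg) auto
  have total: "R + k * t \<le> (\<Sum>a\<in>A. g a)"
  proof -
    have "k * t \<le> (\<Sum>a\<in>D. g a)" using sum_bounded_below[of D t g] t_le D(2) by simp
    then show ?thesis using sum.subset_diff[OF D(1) fin, of g] by (simp add: R_def)
  qed
  show ?thesis
  proof (cases "t = 0")
    case True
    then have "g a = 0" if "a \<in> A - D" for a using t_ge[OF that] nn[of a] that by auto
    then show ?thesis using k by simp
  next
    case False
    then have tpos: "t > 0" using t0 by simp
    define n where "n = R / t"
    have n0: "n \<ge> 0" using R0 tpos by (simp add: n_def)
    have "(\<Sum>a\<in>A - D. g a powr p) \<le> (\<Sum>a\<in>A - D. g a * t powr (p - 1))"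
    proof (rule sum_mono)
      fix a assume a: "a \<in> A - D"
      show "g a powr p \<le> g a * t powr (p - 1)"
      proof (cases "g a = 0")
        case nz: False
        then have "g a powr p = g a * g a powr (p - 1)"
          using nn[of a] a by (simp add: powr_mult_base)
        also have "\<dots> \<le> g a * t powr (p - 1)"
          using nn[of a] a t_ge[OF a] p by (intro mult_left_mono powr_mono2) auto
        finally show ?thesis .
      qed simp
    qed
    also have "\<dots> = n * t powr p"
      unfolding sum_distrib_right[symmetric] R_def[symmetric]
      using tpos by (simp add: n_def powr_diff)
    also have "\<dots> \<le> ((\<mu> - k) * ((n + k) / \<mu>) powr p) * t powr p"
    proof (rule mult_right_mono)
      \<comment> \<open>Young's inequality with conjugate exponents \<open>p\<close> and \<open>\<mu> / k\<close> and second factor \<open>1\<close> is the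
        tangent inequality.\<close>
      have "(n + k) / \<mu> * 1 \<le> ((n + k) / \<mu>) powr p / p + 1 powr (\<mu> / k) / (\<mu> / k)"
        using k n0 p by (intro Youngs_inequality) (auto simp: p_def field_simps)
      then have "(n + k) / \<mu> \<le> ((\<mu> - k) * ((n + k) / \<mu>) powr p + k) / \<mu>"
        by (simp add: p_def add_divide_distrib mult.commute)
      then show "n \<le> (\<mu> - k) * ((n + k) / \<mu>) powr p"
        using k by (simp add: divide_le_cancel)
    qed simp
    also have "\<dots> = (\<mu> - k) * ((R + k * t) / \<mu>) powr p"
    proof -
      have "(n + k) / \<mu> * t = (R + k * t) / \<mu>" using tpos by (simp add: n_def distrib_right)
      moreover have "((n + k) / \<mu> * t) powr p = ((n + k) / \<mu>) powr p * t powr p"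
        by (rule powr_mult)
      ultimately show ?thesis by (simp only: mult.assoc)
    qed
    also have "\<dots> \<le> (\<mu> - k) * ((\<Sum>a\<in>A. g a) / \<mu>) powr p"
      using k total R0 tpos p by (intro mult_left_mono powr_mono2 divide_right_mono) auto
    finally show ?thesis by (simp add: p_def)
  qed
qed

lemma ex_deletion:
  fixes g :: "'b \<Rightarrow> real" and \<mu> :: real
  assumes "finite A" "\<And>a. a \<in> A \<Longrightarrow> 0 \<le> g a" "1 \<le> k" "real k < \<mu>"
  shows "\<exists>D\<subseteq>A. card D \<le> k \<and>
    (\<Sum>a\<in>A - D. g a powr (\<mu> / (\<mu> - k))) \<le> (\<mu> - k) * ((\<Sum>a\<in>A. g a) / \<mu>) powr (\<mu> / (\<mu> - k))"
proof -
  obtain D where D: "D \<subseteq> A" "card D \<le> k"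
    "D = A \<or> card D = k \<and> (\<forall>a\<in>A - D. \<forall>d\<in>D. g a \<le> g d)"
    using ex_largest_elements[OF assms(1)] by blast
  show ?thesis
  proof (cases "D = A")
    case True
    then show ?thesis using D assms(4) by (intro exI[of _ A]) simp
  next
    case False
    then show ?thesis
      using D sum_powr_without_largest[of A g D k \<mu>] assms by (intro exI[of _ D]) blast
  qed
qed

section \<open>Thin forts\<close>

context rooted_tree
begin

text \<open>For \<open>l \<ge> 1\<close>, the limit capacity of a vertex is at most the sum over its children.\<close>
lemma lcap_le_level_sum:
  assumes "1 \<le> l"
  shows "lcap l r \<le> (\<Sum>v\<in>{v \<in> V. depth v = n}. lcap l v)"
proof (induction n)
  case (Suc n)
  have "lcap l v \<le> (\<Sum>w\<in>children v. lcap l w)" for v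
  proof -
    have "lcap l v \<le> (\<Sum>w\<in>children v. lcap l w) / l"
      using limit_capacity_unfold[of l children v] assms by simp
    also have "\<dots> \<le> (\<Sum>w\<in>children v. lcap l w) / 1"
      using assms by (intro divide_left_mono sum_nonneg limit_capacity_nonneg) auto
    finally show ?thesis by simp
  qed
  then have "(\<Sum>v\<in>{v \<in> V. depth v = n}. lcap l v)
      \<le> (\<Sum>v\<in>{v \<in> V. depth v = n}. \<Sum>w\<in>children v. lcap l w)"
    by (rule sum_mono)
  also have "\<dots> = (\<Sum>v\<in>{v \<in> V. depth v = Suc n}. lcap l v)"
    unfolding level_Suc
    by (rule sum.UNION_disjoint[symmetric])
      (use finite_level finite_children parent_unique in auto)
  finally show ?case using Suc.IH by simp
qed (simp only: level_0, simp)

text \<open>The limit capacities vanish everywhere below the root, and levels are finite.\<close>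
lemma ex_small_capacity_on_level:
  assumes "0 < l" "lcap l r = 0" "0 < \<epsilon>"
  shows "\<exists>n'>n. \<forall>v\<in>{v \<in> V. depth v = n}. capacity children l (n' - n) v < \<epsilon>"
proof -
  have "\<forall>\<^sub>F j in sequentially. capacity children l j v < \<epsilon>" if "v \<in> V" for v
    using order_tendstoD(2)[OF capacity_tendsto[OF assms(1), of children v]] assms(3)
      lcap_eq_0[OF assms(1,2) that] by simp
  then have "\<forall>\<^sub>F j in sequentially. \<forall>v\<in>{v \<in> V. depth v = n}. capacity children l j v < \<epsilon>"
    by (intro eventually_ball_finite finite_level) auto
  then obtain j where j: "\<forall>v\<in>{v \<in> V. depth v = n}. capacity children l j v < \<epsilon>" "j > 0"
    using eventually_happens'[OF sequentially_bot eventually_conj[OF _ eventually_gt_at_top[of 0]]] by blast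
  then show ?thesis by (intro exI[of _ "n + j"]) simp
qed

text \<open>
  Between the levels \<open>N m\<close> and \<open>N (Suc m)\<close> the largest capacities for \<open>lam m\<close> are deleted, where the
  capacity of a vertex looks ahead exactly to level \<open>N (Suc m)\<close>. For \<open>l \<ge> lam m - k\<close> the capacities
  for \<open>l\<close> in the fort are then bounded by powers of the capacities for \<open>lam m\<close> in the tree, which
  are tiny on level \<open>N m\<close>. Summing over this level bounds the limit capacity of the fort at the
  root by \<open>1 / (m + 1)\<close>, for all large \<open>m\<close> once \<open>l > b - k\<close>.
\<close>
lemma thin_fort:
  assumes k: "1 \<le> k" "real k + 1 \<le> b" and zero: "\<And>l. b < l \<Longrightarrow> lcap l r = 0"
  shows "\<exists>D. k_fort k V E (pruned D) \<and>
    (\<forall>l>b - k. limit_capacity (tree_children (induced_edges E (pruned D)) r) l r = 0)"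
proof -
  define lam where "lam m = b + 1 / (real m + 1)" for m :: nat
  \<comment> \<open>Small enough for the sum over level \<open>n\<close> to stay below \<open>1 / (m + 1)\<close>; the extra \<open>1\<close> keeps the
    denominator positive.\<close>
  define \<epsilon> where "\<epsilon> m n = 1 / ((real m + 1) * (real (card {v \<in> V. depth v = n}) + 1))" for m n :: nat
  have lam: "b < lam m" "real k < lam m" "0 < lam m" for m
  proof -
    have "1 / (real m + 1) > 0" by simp
    then show "b < lam m" "real k < lam m" "0 < lam m" using k unfolding lam_def by linarith+
  qed
  have \<epsilon>: "\<epsilon> m n > 0" for m n by (simp add: \<epsilon>_def add_nonneg_pos)
  have "\<exists>N. \<forall>m::nat. True \<and> (N m < N (Suc m) \<and>
      (\<forall>v\<in>{v \<in> V. depth v = N m}. capacity children (lam m) (N (Suc m) - N m) v < \<epsilon> m (N m)))"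
    by (rule dependent_nat_choice)
      (use ex_small_capacity_on_level[OF lam(3) zero[OF lam(1)] \<epsilon>] in auto)
  then obtain N where N: "\<And>m. N m < N (Suc m)"
    and small: "\<And>m v. v \<in> V \<Longrightarrow> depth v = N m \<Longrightarrow>
       capacity children (lam m) (N (Suc m) - N m) v < \<epsilon> m (N m)" by auto
  have mono: "mono N" using N by (meson less_imp_le mono_iff_le_Suc)
  define stage where "stage d = (LEAST m. d < N (Suc m))" for d
  have stage: "stage d = m" if "N m \<le> d" "d < N (Suc m)" for d m
    unfolding stage_def
  proof (rule Least_equality)
    fix y assume "d < N (Suc y)"
    then have "\<not> Suc y \<le> m" using monoD[OF mono, of "Suc y" m] that(1) by auto
    then show "m \<le> y" by simp
  qed (rule that(2))
  \<comment> \<open>The children of \<open>v\<close> are one generation closer to the next block than \<open>v\<close>, hence the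
    \<open>Suc\<close>.\<close>
  define g where "g v = capacity children (lam (stage (depth v))) (N (Suc (stage (depth v))) - Suc (depth v))" for v
  define a where "a m = lam m / (lam m - k)" for m
  have "\<exists>D\<subseteq>children v. card D \<le> k \<and>
      (\<Sum>w\<in>children v - D. g v w powr a (stage (depth v)))
        \<le> (lam (stage (depth v)) - k) * ((\<Sum>w\<in>children v. g v w) / lam (stage (depth v))) powr a (stage (depth v))" for v
    unfolding a_def
    by (rule ex_deletion) (use k lam finite_children in \<open>auto simp: g_def intro: capacity_nonneg\<close>)
  then obtain D where D: "\<And>v. D v \<subseteq> children v" "\<And>v. card (D v) \<le> k"
    and D_sum: "\<And>v. (\<Sum>w\<in>children v - D v. g v w powr a (stage (depth v)))
        \<le> (lam (stage (depth v)) - k) * ((\<Sum>w\<in>children v. g v w) / lam (stage (depth v))) powr a (stage (depth v))"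
    by metis
  interpret P: rooted_tree "pruned D" "induced_edges E (pruned D)" r by (rule pruned_rooted_tree)
  have compare: "capacity P.children l n v \<le> capacity children (lam m) n v powr a m"
    if l: "lam m - k \<le> l" and v: "v \<in> pruned D" "N m \<le> depth v" "depth v + n = N (Suc m)" for l m n v
    using v
  proof (induction n arbitrary: v)
    case (Suc n)
    have st: "stage (depth v) = m" using Suc.prems by (intro stage) auto
    have "N (Suc m) - Suc (depth v) = n" using Suc.prems(3) by linarith
    then have gv: "g v = capacity children (lam m) n" by (simp only: g_def st)
    have pos: "0 < lam m - k" "0 < l" using lam(2)[of m] l by auto
    define y where "y = (\<Sum>w\<in>children v. capacity children (lam m) n w) / lam m"
    have "(\<Sum>w\<in>P.children v. capacity P.children l n w) / l
        \<le> (\<Sum>w\<in>children v - D v. capacity children (lam m) n w powr a m) / l"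
    proof (intro divide_right_mono)
      show "(\<Sum>w\<in>P.children v. capacity P.children l n w)
        \<le> (\<Sum>w\<in>children v - D v. capacity children (lam m) n w powr a m)"
        unfolding pruned_children[OF Suc.prems(1)]
        by (rule sum_mono, rule Suc.IH) (use Suc.prems pruned.child child_depth in auto)
    qed (use pos in simp)
    also have "\<dots> \<le> (\<Sum>w\<in>children v - D v. capacity children (lam m) n w powr a m) / (lam m - k)"
      using l pos by (intro divide_left_mono sum_nonneg) auto
    also have "\<dots> \<le> ((lam m - k) * y powr a m) / (lam m - k)"
      using D_sum[of v] pos unfolding st gv y_def by (intro divide_right_mono) auto
    also have "\<dots> = y powr a m" using pos by simp
    finally have le: "(\<Sum>w\<in>P.children v. capacity P.children l n w) / l \<le> y powr a m" .
    show ?case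
      using le by (cases "y \<le> 1") (simp_all add: y_def[symmetric] min_def)
  qed simp
  have bound: "P.lcap l r \<le> 1 / (real m + 1)" if l: "1 \<le> l" "lam m - k \<le> l" for l m
  proof -
    let ?L = "{v \<in> pruned D. P.depth v = N m}"
    have sub: "?L \<subseteq> {v \<in> V. depth v = N m}"
      using pruned_subset pruned_depth by auto
    have "P.lcap l v \<le> \<epsilon> m (N m)" if v: "v \<in> ?L" for v
    proof -
      let ?n = "N (Suc m) - N m"
      let ?c = "capacity children (lam m) ?n v"
      have dv: "v \<in> V" "v \<in> pruned D" "depth v = N m" using v sub by auto
      have "P.lcap l v \<le> capacity P.children l ?n v"
        using l by (intro limit_capacity_le) simp
      also have "\<dots> \<le> ?c powr a m"
        using compare[OF l(2) dv(2), of ?n] dv(3) N[of m] by simp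
      also have "\<dots> \<le> ?c powr 1"
      proof (rule powr_mono')
        show "1 \<le> a m" using lam(2)[of m] by (simp add: a_def)
      qed (use capacity_nonneg[OF lam(3)[of m], of children ?n v] capacity_le_1 in auto)
      also have "\<dots> \<le> \<epsilon> m (N m)"
        using small[OF dv(1,3)] capacity_nonneg[OF lam(3)[of m], of children ?n v] by simp
      finally show ?thesis .
    qed
    then have "(\<Sum>v\<in>?L. P.lcap l v) \<le> real (card ?L) * \<epsilon> m (N m)"
      by (rule sum_bounded_above)
    also have "\<dots> \<le> real (card {v \<in> V. depth v = N m} + 1) * \<epsilon> m (N m)"
      using card_mono[OF finite_level sub] \<epsilon>[of m "N m"] by (intro mult_right_mono) auto
    also have "\<dots> = 1 / (real m + 1)"
      by (simp add: \<epsilon>_def add.commute add_nonneg_pos)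
    finally show ?thesis using P.lcap_le_level_sum[OF l(1), of "N m"] by linarith
  qed
  have "P.lcap l r = 0" if "b - k < l" for l
  proof -
    have l: "1 \<le> l" using that k by linarith
    have lim: "(\<lambda>m. 1 / (real m + 1)) \<longlonglongrightarrow> 0"
      using LIMSEQ_inverse_real_of_nat by (simp add: inverse_eq_divide add.commute)
    then have "\<forall>\<^sub>F m in sequentially. 1 / (real m + 1) < l - (b - k)"
      using that by (intro order_tendstoD(2)[OF lim]) simp
    then have "\<forall>\<^sub>F m in sequentially. P.lcap l r \<le> 1 / (real m + 1)"
      by eventually_elim (use l bound in \<open>auto simp: lam_def\<close>)
    then have "P.lcap l r \<le> 0"
      by (intro tendsto_lowerbound[OF lim]) auto
    then show ?thesis using limit_capacity_nonneg[of l P.children r] l by simp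
  qed
  then show ?thesis using pruned_fort[of D k] D by blast
qed

end

lemma branching_number_finite: "finite V \<Longrightarrow> branching_number V E = 0"
  by (simp add: branching_number_def rooted_branching_number_def)

theorem theorem1p3:
  fixes V :: "'a set" and E :: "('a \<times> 'a) set" and k :: nat and x :: 'a
  assumes "graph_tree V E"
    and "infinite V"
    and "locally_finite_graph V E"
    and "k \<ge> 1"
    and "x \<in> V"
  shows "\<exists>F. x \<in> F \<and> k_fort k V E F \<and>
           branching_number F (induced_edges E F) \<le> max (branching_number V E - ereal (real k)) 0"
proof -
  interpret rooted_tree V E x
    using assms by unfold_locales
  consider (infinite) "branching_number V E = \<infinity>"
    | (small) "branching_number V E < ereal (real k + 1)"
    | (large) b where "branching_number V E = ereal b" "real k + 1 \<le> b"
  proof (cases "branching_number V E")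
    case (real b)
    then show ?thesis using that(2) that(3)[of b] by (cases "b < real k + 1") auto
  qed (use that(1,2) in auto)
  then show ?thesis
  proof cases
    case infinite
    have "k_fort k V E V" "induced_edges E V = E"
      using assms(1,5) by (auto simp: k_fort_def induced_edges_def graph_tree_def simple_graph_def Int_absorb2)
    then show ?thesis using infinite assms(5) by (intro exI[of _ V]) (simp add: max_def)
  next
    case small
    then have "lcap (real k + 1) x = 0"
      using assms(2) by (intro lcap_eq_0_above_branching_number) auto
    then obtain F where "x \<in> F" "k_fort k V E F" "finite F" using finite_fort by blast
    then show ?thesis by (intro exI[of _ F]) (simp add: branching_number_finite)
  next
    case large
    have "lcap l x = 0" if "b < l" for l
      using that large by (intro lcap_eq_0_above_branching_number assms(2)) auto
    then obtain D where D: "k_fort k V E (pruned D)"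
      and zero: "\<And>l. b - k < l \<Longrightarrow>
        limit_capacity (tree_children (induced_edges E (pruned D)) x) l x = 0"
      using thin_fort[OF assms(4) large(2)] by blast
    let ?F = "pruned D"
    interpret P: rooted_tree ?F "induced_edges E ?F" x by (rule pruned_rooted_tree)
    have "branching_number ?F (induced_edges E ?F) \<le> max (ereal (b - k)) 0"
    proof (cases "finite ?F")
      case False
      have "branching_number ?F (induced_edges E ?F) \<le> ereal (b - k)"
        by (rule P.branching_number_le[OF False]) (use zero in \<open>force simp: not_less[symmetric]\<close>)
      then show ?thesis by (simp add: le_max_iff_disj)
    qed (simp add: branching_number_finite)
    then show ?thesis using D pruned.root large(1) by (intro exI[of _ ?F]) simp
  qed
qed

end
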